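(* Let $\mathbf P$ be a pentagon (no two consecutive sides of which are parallel). Then its third $\mathcal P$-evolute $\mathcal P^3(\mathbf P)$ is homothetic to its first $\mathcal P$-evolute $\mathcal P(\mathbf P)$: there are $c\in\mathbb R$ and $v\in\mathbb R^2$ such that the map $x\mapsto cx+v$ sends each vertex of $\mathcal P(\mathbf P)$ to the corresponding vertex of $\mathcal P^3(\mathbf P)$.
   Context: A polygon is given by a cyclic sequence of lines $l_1,\dots,l_n$ (its sides; indices mod $n$), consecutive ones being non-parallel; its vertices are $P_{j+\frac12}=l_j\cap l_{j+1}$. The $\mathcal P$-evolute $\mathcal P(\mathbf P)$ is the polygon with sides $l_1^*,\dots,l_n^*$, where $l_j^*$ is the line perpendicular to $l_j$ through the midpoint of the segment $P_{j-\frac12}P_{j+\frac12}$ (if $P_{j-\frac12}=P_{j+\frac12}$, the line perpendicular to $l_j$ through this point). Polygons are allowed to be degenerate (e.g. all lines through one point). $\mathcal P^k$ denotes the $k$-th iterate; vertices $P_{j+\frac12}$ of the iterates correspond by index. *)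

theory Defs
  imports "HOL-Analysis.Analysis"
begin

definition is_line :: "(real^2) set \<Rightarrow> bool" where
  "is_line L \<longleftrightarrow> affine L \<and> aff_dim L = 1"

text \<open>
  The cyclic sequence of sides is an \<open>n\<close>-periodic family indexed by all integers, so that index
  arithmetic modulo \<open>n\<close> is ordinary integer arithmetic. Note that \<^const>\<open>affine_parallel\<close> holds in
  particular for equal lines, so consecutive sides are distinct. No other position is excluded:
  sides may be concurrent and non-consecutive sides may coincide.
\<close>

definition polygon :: "nat \<Rightarrow> (int \<Rightarrow> (real^2) set) \<Rightarrow> bool" where
  "polygon n l \<longleftrightarrow> n > 0 \<and> (\<forall>j. l (j + int n) = l j) \<and> (\<forall>j. is_line (l j)) \<and>
     (\<forall>j. \<not> affine_parallel (l j) (l (j + 1)))"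

text \<open>
  \<open>vertex l j\<close> is \<open>P\<^bsub>j+1/2\<^esub>\<close>, the intersection point of the sides \<open>j\<close> and \<open>j + 1\<close>; hence the
  vertices lying on side \<open>j\<close> are \<open>vertex l (j - 1)\<close> and \<open>vertex l j\<close>.
\<close>

definition vertex :: "(int \<Rightarrow> (real^2) set) \<Rightarrow> int \<Rightarrow> real^2" where
  "vertex l j = (THE x. x \<in> l j \<inter> l (j + 1))"

definition perpendicular_through :: "(real^2) set \<Rightarrow> real^2 \<Rightarrow> (real^2) set" where
  "perpendicular_through L m = {x. \<forall>a\<in>L. \<forall>b\<in>L. orthogonal (x - m) (b - a)}"

text \<open>
  If the two vertices on a side coincide, their midpoint is that common point, so the degenerate
  case needs no separate clause.
\<close>

definition P_evolute :: "(int \<Rightarrow> (real^2) set) \<Rightarrow> int \<Rightarrow> (real^2) set" where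
  "P_evolute l j = perpendicular_through (l j) (midpoint (vertex l (j - 1)) (vertex l j))"

end

theory Submission imports Defs begin

text \<open>
  Fix unit direction vectors of the sides. Up to translation a pentagon with these directions is
  given by its five signed side lengths, subject to the vector equation that it closes up; this is a
  three-dimensional space. Taking the evolute rotates the directions by a right angle and acts on
  the side lengths by a linear map that depends on the directions only. On the three-dimensional
  space this map has trace and determinant zero, so by Cayley--Hamilton its cube is a multiple of
  itself. Hence the sides of the third evolute are parallel to those of the first one, with lengths
  in a common ratio.
\<close>


section \<open>Plane vectors: oriented angles and perpendicular bisectors\<close>

definition cross2 :: "real^2 \<Rightarrow> real^2 \<Rightarrow> real" where
  "cross2 x y = x$1 * y$2 - x$2 * y$1"

definition rot :: "real^2 \<Rightarrow> real^2" where
  "rot x = vector [- (x$2), x$1]"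

lemma rot_nth [simp]: "rot x $ 1 = - (x$2)" "rot x $ 2 = x$1"
  by (simp_all add: rot_def)

lemma inner_R2: "x \<bullet> y = x$1 * y$1 + x$2 * y$2" for x y :: "real^2"
  by (simp add: inner_vec_def sum_2)

lemma inner_rot [simp]: "rot x \<bullet> rot y = x \<bullet> y"
  by (simp add: inner_R2)

lemma cross2_rot [simp]: "cross2 (rot x) (rot y) = cross2 x y"
  by (simp add: cross2_def)

lemma rot_rot_rot: "rot (rot (rot x)) = - rot x"
  by (simp add: vec_eq_iff forall_2)

lemma unit_expansion:
  assumes "d \<bullet> d = 1"
  shows "x = (x \<bullet> d) *\<^sub>R d + (x \<bullet> rot d) *\<^sub>R rot d"
  using assms unfolding vec_eq_iff forall_2 inner_R2
  by simp algebra

text \<open>These are the addition formulas for sine and cosine: between unit vectors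
  \<open>cross2\<close> is the sine and the inner product the cosine of the oriented angle, and the
  angle from \<open>d\<close> to \<open>f\<close> is split at \<open>e\<close>.\<close>

lemma cross2_step:
  assumes "e \<bullet> e = 1"
  shows "cross2 d f = cross2 d e * (e \<bullet> f) + (d \<bullet> e) * cross2 e f"
    and "d \<bullet> f = (d \<bullet> e) * (e \<bullet> f) - cross2 d e * cross2 e f"
  using assms unfolding cross2_def inner_R2 by algebra+

text \<open>Here \<open>x\<close> and \<open>y\<close> stand for the position of one evolute vertex
  relative to the midpoints of two adjacent sides. As \<open>x\<close> is a multiple of
  \<open>rot d\<close>, its coefficient can be read off from \<open>x \<bullet> e\<close>, and this
  equals \<open>(x - y) \<bullet> e\<close> because \<open>y\<close> is orthogonal to
  \<open>e\<close>; similarly for \<open>y\<close>.\<close>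

lemma bisector_offset:
  assumes "d \<bullet> d = 1" "e \<bullet> e = 1" "x \<bullet> d = 0" "y \<bullet> e = 0"
    and "x - y = (1/2) *\<^sub>R (a *\<^sub>R d + b *\<^sub>R e)"
  shows "cross2 d e * (x \<bullet> rot d) = (a * (d \<bullet> e) + b) / 2"
    and "cross2 d e * (y \<bullet> rot e) = (a + b * (d \<bullet> e)) / 2"
proof -
  have x: "x = (x \<bullet> rot d) *\<^sub>R rot d" and y: "y = (y \<bullet> rot e) *\<^sub>R rot e"
    using unit_expansion[of d x] unit_expansion[of e y] assms by auto
  have "cross2 d e * (x \<bullet> rot d) = x \<bullet> e"
    by (subst (2) x) (simp add: inner_R2 cross2_def algebra_simps)
  also have "\<dots> = (x - y) \<bullet> e"
    using assms(4) by (simp add: inner_diff_left)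
  finally show "cross2 d e * (x \<bullet> rot d) = (a * (d \<bullet> e) + b) / 2"
    unfolding assms(5) using assms(1,2) by (simp add: inner_add_left)
  have "cross2 d e * (y \<bullet> rot e) = - (y \<bullet> d)"
    by (subst (2) y) (simp add: inner_R2 cross2_def algebra_simps)
  also have "\<dots> = (x - y) \<bullet> d"
    using assms(3) by (simp add: inner_diff_left)
  finally show "cross2 d e * (y \<bullet> rot e) = (a + b * (d \<bullet> e)) / 2"
    unfolding assms(5) using assms(1,2) by (simp add: inner_add_right inner_commute)
qed

section \<open>Sides with chosen unit directions\<close>

definition directed :: "(int \<Rightarrow> (real^2) set) \<Rightarrow> (int \<Rightarrow> real^2) \<Rightarrow> bool" where
  "directed l d \<longleftrightarrow> (\<forall>j. d j \<bullet> d j = 1 \<and> cross2 (d j) (d (j+1)) \<noteq> 0 \<and>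
     (\<exists>p. l j = {x. cross2 (d j) (x - p) = 0}))"

lemma line_cross2:
  assumes "is_line L"
  obtains d p where "d \<bullet> d = 1" "L = {x. cross2 d (x - p) = 0}"
proof -
  have aff: "affine L" "aff_dim L = 1"
    using assms by (auto simp: is_line_def)
  have "L \<noteq> {}" "\<And>p. L \<noteq> {p}" 
    using aff(2) by auto
  then obtain p q where pq: "p \<in> L" "q \<in> L" "p \<noteq> q" by blast
  define d where "d = sgn (q - p)"
  have d: "d \<bullet> d = 1"
    using pq by (simp add: d_def norm_sgn dot_square_norm)
  have hull: "L = affine hull {p, q}"
  proof -
    have "aff_dim (affine hull {p, q}) = 1"
      using pq by (simp add: aff_dim_affine_hull aff_dim_2)
    moreover have "affine hull {p, q} \<subseteq> L"
      using pq aff by (simp add: hull_minimal)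
    ultimately show ?thesis
      using affine_dim_equal[of "affine hull {p,q}" L] aff by simp
  qed
  have "L = {x. cross2 d (x - p) = 0}"
  proof (intro set_eqI iffI)
    fix x assume "x \<in> L"
    then obtain u v where "x = u *\<^sub>R p + v *\<^sub>R q" "u + v = 1"
      unfolding hull affine_hull_2 by blast
    then have "x = (1 - v) *\<^sub>R p + v *\<^sub>R q" by (simp add: eq_diff_eq)
    then have "x = p + v *\<^sub>R (q - p)" by (simp add: algebra_simps)
    then have "x - p = v *\<^sub>R (q - p)" by simp
    moreover have "cross2 d (v *\<^sub>R (q - p)) = 0"
      unfolding d_def sgn_div_norm by (simp add: cross2_def)
    ultimately show "x \<in> {x. cross2 d (x - p) = 0}" by simp
  next
    fix x assume "x \<in> {x. cross2 d (x - p) = 0}"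
    then have "(x - p) \<bullet> rot d = 0"
      by (simp add: cross2_def inner_R2 algebra_simps)
    then have "x - p = ((x - p) \<bullet> d) *\<^sub>R d"
      using unit_expansion[OF d, of "x - p"] by simp
    then obtain t where "x - p = t *\<^sub>R d" by blast
    then have "x - p = (t / norm (q - p)) *\<^sub>R (q - p)"
      by (simp add: d_def sgn_div_norm divide_inverse)
    then obtain u where "x - p = u *\<^sub>R (q - p)" by blast
    then have "x = (1 - u) *\<^sub>R p + u *\<^sub>R q"
      by (simp add: algebra_simps)
    then show "x \<in> L"
      using pq aff unfolding affine_alt by blast
  qed
  with d show thesis by (rule that)
qed

lemma cross2_line_parallel:
  assumes "L = {x. cross2 d (x - p) = 0}" "M = {x. cross2 e (x - q) = 0}"
    and "d \<bullet> d = 1" "e \<bullet> e = 1" "cross2 d e = 0"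
  shows "affine_parallel L M"
proof -
  have "e = (e \<bullet> d) *\<^sub>R d"
  proof -
    have "e \<bullet> rot d = 0" using assms(5) by (simp add: cross2_def inner_R2 mult.commute)
    then show ?thesis using unit_expansion[OF assms(3), of e] by simp
  qed
  then have e: "e = (e \<bullet> d) *\<^sub>R d" and nz: "e \<bullet> d \<noteq> 0"
    using assms(4) by auto
  have *: "cross2 e x = 0 \<longleftrightarrow> cross2 d x = 0" for x
    by (subst e) (use nz in \<open>auto simp: cross2_def algebra_simps\<close>)
  have "M = (+) (q - p) ` L"
  proof (intro set_eqI iffI)
    fix x assume "x \<in> M"
    then have "x - (q - p) \<in> L" using assms * by (simp add: algebra_simps)
    then show "x \<in> (+) (q - p) ` L" by (metis add.commute diff_add_cancel imageI)
  next
    fix x assume "x \<in> (+) (q - p) ` L"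
    then obtain y where "x = (q - p) + y" "cross2 d (y - p) = 0"
      unfolding assms(1) by blast
    then have "x - q = y - p" "cross2 d (y - p) = 0" by (simp_all add: algebra_simps)
    then show "x \<in> M" unfolding assms(2) mem_Collect_eq * by simp
  qed
  then show ?thesis by (auto simp: affine_parallel_def)
qed

lemma polygon_directed:
  assumes "polygon n l"
  obtains d where "directed l d" "\<And>j. d (j + int n) = d j"
proof -
  have ex: "\<exists>d. d \<bullet> d = 1 \<and> (\<exists>p. l j = {x. cross2 d (x - p) = 0})" for j
    using assms line_cross2[of "l j"] unfolding polygon_def by metis
  \<comment> \<open>The choice depends only on the set \<open>l j\<close>, so equal sides receive
    the same direction and \<open>d\<close> inherits the period of \<open>l\<close>.\<close>
  define d where "d j = (SOME d. d \<bullet> d = 1 \<and> (\<exists>p. l j = {x. cross2 d (x - p) = 0}))" for j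
  have d: "d j \<bullet> d j = 1" "\<exists>p. l j = {x. cross2 (d j) (x - p) = 0}" for j
    using someI_ex[OF ex[of j]] by (auto simp: d_def)
  have "cross2 (d j) (d (j + 1)) \<noteq> 0" for j
    using cross2_line_parallel d assms unfolding polygon_def by metis
  with d have "directed l d" by (auto simp: directed_def)
  moreover have "d (j + int n) = d j" for j
    using assms by (simp add: d_def polygon_def)
  ultimately show thesis by (rule that)
qed

lemma vertex_mem:
  assumes "directed l d"
  shows "vertex l j \<in> l j \<inter> l (j + 1)"
proof -
  obtain p q where p: "l j = {x. cross2 (d j) (x - p) = 0}"
    and q: "l (j + 1) = {x. cross2 (d (j + 1)) (x - q) = 0}"
    using assms unfolding directed_def by metis
  have nz: "cross2 (d j) (d (j + 1)) \<noteq> 0"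
    using assms by (simp add: directed_def)
  \<comment> \<open>A point \<open>p - t *\<^sub>R d j\<close> of side \<open>j\<close>, with
    \<open>t\<close> solved from the equation of side \<open>j + 1\<close>.\<close>
  define x where "x = p - (cross2 (d (j + 1)) (q - p) / cross2 (d j) (d (j + 1))) *\<^sub>R d j"
  have "x \<in> l j \<inter> l (j + 1)"
    using nz unfolding p q x_def
    by (simp add: cross2_def divide_simps) algebra
  moreover have "y = x" if "y \<in> l j \<inter> l (j + 1)" for y
  proof -
    have "cross2 (d j) (y - x) = 0" "cross2 (d (j + 1)) (y - x) = 0"
      using that \<open>x \<in> l j \<inter> l (j + 1)\<close> unfolding p q by (auto simp: cross2_def algebra_simps)
    then have "y $ 1 - x $ 1 = 0 \<and> y $ 2 - x $ 2 = 0"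
      using nz unfolding cross2_def vector_minus_component by algebra
    then show "y = x" by (simp add: vec_eq_iff forall_2)
  qed
  ultimately show ?thesis
    unfolding vertex_def by (rule theI)
qed

lemma directed_line:
  assumes "directed l d" "y \<in> l j"
  shows "l j = {x. (x - y) \<bullet> rot (d j) = 0}"
proof -
  obtain p where p: "l j = {x. cross2 (d j) (x - p) = 0}"
    using assms unfolding directed_def by metis
  show ?thesis using assms(2) unfolding p by (auto simp: cross2_def inner_R2 algebra_simps)
qed

section \<open>Signed side lengths and their change under the evolute\<close>

definition side :: "(int \<Rightarrow> (real^2) set) \<Rightarrow> (int \<Rightarrow> real^2) \<Rightarrow> int \<Rightarrow> real" where
  "side l d j = (vertex l j - vertex l (j - 1)) \<bullet> d j"

lemma vertex_diff:
  assumes "directed l d"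
  shows "vertex l j - vertex l (j - 1) = side l d j *\<^sub>R d j"
proof -
  have "vertex l j \<in> l j" "vertex l (j - 1) \<in> l j"
    using vertex_mem[OF assms, of j] vertex_mem[OF assms, of "j - 1"] by auto
  then have "(vertex l j - vertex l (j - 1)) \<bullet> rot (d j) = 0"
    using directed_line[OF assms] by blast
  then show ?thesis
    using unit_expansion[of "d j" "vertex l j - vertex l (j - 1)"] assms
    by (simp add: directed_def side_def)
qed

lemma P_evolute_line:
  assumes "directed l d"
  shows "P_evolute l j = {x. (x - midpoint (vertex l (j - 1)) (vertex l j)) \<bullet> d j = 0}"
proof -
  let ?m = "midpoint (vertex l (j - 1)) (vertex l j)"
  let ?v = "vertex l j"
  have v: "?v \<in> l j" using vertex_mem[OF assms] by auto
  note L = directed_line[OF assms v]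
  have dd: "d j \<bullet> d j = 1" using assms by (simp add: directed_def)
  \<comment> \<open>A second point of the side: its difference from \<open>?v\<close> is
    \<open>d j\<close>, so orthogonality to all differences on the line includes orthogonality to
    \<open>d j\<close>.\<close>
  have "?v + d j \<in> l j" by (simp add: L inner_R2)
  then have "(x - ?m) \<bullet> d j = 0" if "x \<in> P_evolute l j" for x
    using that v unfolding P_evolute_def perpendicular_through_def orthogonal_def
    by (metis (mono_tags, lifting) add_diff_cancel_left' mem_Collect_eq)
  moreover have "x \<in> P_evolute l j" if "(x - ?m) \<bullet> d j = 0" for x
    unfolding P_evolute_def perpendicular_through_def orthogonal_def
  proof safe
    fix a b assume "a \<in> l j" "b \<in> l j"
    then have "(b - a) \<bullet> rot (d j) = 0"
      using directed_line[OF assms] by blast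
    then have "b - a = ((b - a) \<bullet> d j) *\<^sub>R d j"
      using unit_expansion[OF dd, of "b - a"] by simp
    then show "(x - ?m) \<bullet> (b - a) = 0"
      using that by (metis inner_scaleR_right mult_zero_right)
  qed
  ultimately show ?thesis by blast
qed

lemma directed_P_evolute:
  assumes "directed l d"
  shows "directed (P_evolute l) (\<lambda>j. rot (d j))"
proof -
  have "\<exists>p. P_evolute l j = {x. cross2 (rot (d j)) (x - p) = 0}" for j
    unfolding P_evolute_line[OF assms]
    by (rule exI[of _ "midpoint (vertex l (j - 1)) (vertex l j)"])
      (auto simp: cross2_def inner_R2 algebra_simps)
  then show ?thesis using assms by (simp add: directed_def)
qed

text \<open>With \<open>s\<close> and \<open>c\<close> the sines and cosines of the turning angles,
  the two quotients, halved, are the offsets of the evolute vertices \<open>j\<close> and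
  \<open>j - 1\<close> from the midpoint of side \<open>j\<close>, measured along
  \<open>rot (d j)\<close>.\<close>

definition evolute_sides :: "(int \<Rightarrow> real) \<Rightarrow> (int \<Rightarrow> real) \<Rightarrow> (int \<Rightarrow> real) \<Rightarrow> int \<Rightarrow> real" where
  "evolute_sides s c a j =
     ((a j * c j + a (j + 1)) / s j - (a (j - 1) + a j * c (j - 1)) / s (j - 1)) / 2"

lemma side_P_evolute:
  assumes "directed l d"
  shows "side (P_evolute l) (\<lambda>j. rot (d j)) =
    evolute_sides (\<lambda>j. cross2 (d j) (d (j + 1))) (\<lambda>j. d j \<bullet> d (j + 1)) (side l d)"
proof
  fix j
  define m where "m j = midpoint (vertex l (j - 1)) (vertex l j)" for j
  define w where "w = vertex (P_evolute l)"
  have u: "d j \<bullet> d j = 1" and nz: "cross2 (d j) (d (j + 1)) \<noteq> 0" for j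
    using assms by (auto simp: directed_def)
  have w: "(w j - m j) \<bullet> d j = 0" "(w j - m (j + 1)) \<bullet> d (j + 1) = 0" for j
    using vertex_mem[OF directed_P_evolute[OF assms], of j]
    by (auto simp: P_evolute_line[OF assms] m_def w_def)
  \<comment> \<open>The vertex \<open>w j\<close> lies on the bisectors of sides \<open>j\<close>
    and \<open>j + 1\<close>, whose midpoints are joined by half of each side.\<close>
  have diff: "(w j - m j) - (w j - m (j + 1)) =
      (1/2) *\<^sub>R (side l d j *\<^sub>R d j + side l d (j + 1) *\<^sub>R d (j + 1))" for j
    unfolding vertex_diff[OF assms, symmetric]
    by (simp add: m_def midpoint_def algebra_simps)
  note off = bisector_offset[OF u u w diff]
  have 1: "(w j - m j) \<bullet> rot (d j) =
      (side l d j * (d j \<bullet> d (j + 1)) + side l d (j + 1)) / 2 / cross2 (d j) (d (j + 1))"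
    using off(1)[of j] nz[of j] by (simp add: field_simps)
  \<comment> \<open>For the vertex \<open>j - 1\<close>, side \<open>j\<close> is the second of the
    two adjacent sides, hence the other half of \<open>bisector_offset\<close>.\<close>
  have 2: "(w (j - 1) - m j) \<bullet> rot (d j) =
      (side l d (j - 1) + side l d j * (d (j - 1) \<bullet> d j)) / 2 / cross2 (d (j - 1)) (d j)"
    using off(2)[of "j - 1"] nz[of "j - 1"] by (simp add: field_simps)
  have "side (P_evolute l) (\<lambda>j. rot (d j)) j =
      (w j - m j) \<bullet> rot (d j) - (w (j - 1) - m j) \<bullet> rot (d j)"
    by (simp add: side_def w_def inner_diff_left)
  then show "side (P_evolute l) (\<lambda>j. rot (d j)) j =
    evolute_sides (\<lambda>j. cross2 (d j) (d (j + 1))) (\<lambda>j. d j \<bullet> d (j + 1)) (side l d) j"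
    unfolding 1 2 by (simp add: evolute_sides_def diff_divide_distrib)
qed

section \<open>Cayley--Hamilton in dimension three, and the determinant in terms of
  cotangents\<close>

lemma traceless_singular_cube:
  fixes m11 :: real
  assumes trace: "m11 + m22 + m33 = 0"
    and det: "m11 * (m22 * m33 - m23 * m32) - m12 * (m21 * m33 - m23 * m31)
      + m13 * (m21 * m32 - m22 * m31) = 0"
    and y: "y1 = m11 * x1 + m12 * x2 + m13 * x3" "y2 = m21 * x1 + m22 * x2 + m23 * x3"
      "y3 = m31 * x1 + m32 * x2 + m33 * x3"
    and z: "z1 = m11 * y1 + m12 * y2 + m13 * y3" "z2 = m21 * y1 + m22 * y2 + m23 * y3"
      "z3 = m31 * y1 + m32 * y2 + m33 * y3"
    and w: "w1 = m11 * z1 + m12 * z2 + m13 * z3" "w2 = m21 * z1 + m22 * z2 + m23 * z3"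
      "w3 = m31 * z1 + m32 * z2 + m33 * z3"
  obtains c where "w1 = c * y1" "w2 = c * y2" "w3 = c * y3"
proof
  \<comment> \<open>Minus the sum of the principal 2 x 2 minors, the only coefficient of the
    characteristic polynomial that survives besides the leading one.\<close>
  let ?c = "m12 * m21 + m13 * m31 + m23 * m32 - m11 * m22 - m11 * m33 - m22 * m33"
  let ?D = "m11 * (m22 * m33 - m23 * m32) - m12 * (m21 * m33 - m23 * m31)
      + m13 * (m21 * m32 - m22 * m31)"
  have "w1 = (m11 + m22 + m33) * z1 + ?c * y1 + ?D * x1" unfolding w z y by algebra
  then show "w1 = ?c * y1" unfolding trace det by simp
  have "w2 = (m11 + m22 + m33) * z2 + ?c * y2 + ?D * x2" unfolding w z y by algebra
  then show "w2 = ?c * y2" unfolding trace det by simp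
  have "w3 = (m11 + m22 + m33) * z3 + ?c * y3 + ?D * x3" unfolding w z y by algebra
  then show "w3 = ?c * y3" unfolding trace det by simp
qed

text \<open>
  Here \<open>s\<^sub>j\<close> and \<open>k\<^sub>j\<close> are the sine and the cotangent of the angle from side \<open>j\<close> to side \<open>j + 1\<close>, and
  the determinant is that of twice the map on side lengths in the coordinates \<open>a\<^sub>0, a\<^sub>1, a\<^sub>2\<close>. Since
  the five angles add up to a multiple of \<open>2 * pi\<close>, \<open>s\<^sub>4\<close> is minus the sine of the sum of the first four.
\<close>

lemma pentagon_det_cot:
  fixes k0 k1 k2 k3 :: real
  assumes s: "s0^2 * (1 + k0^2) = 1" "s1^2 * (1 + k1^2) = 1" "s2^2 * (1 + k2^2) = 1"
      "s3^2 * (1 + k3^2) = 1"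
    and E: "E = k0*k1*k2 + k0*k1*k3 + k0*k2*k3 + k1*k2*k3 - k0 - k1 - k2 - k3" "E \<noteq> 0"
    and F: "F = k1*k2 + k1*k3 + k2*k3 - 1"
    and s4: "s4 = - (s0 * s1 * s2 * s3 * E)"
  defines "m12 \<equiv> 1/s0 - s1 * s2 * (k1 + k2) / (s3 * s4)"
    and "m13 \<equiv> - s2 / (s3 * s4)"
    and "m31 \<equiv> s4 / (s2 * s3)"
    and "m32 \<equiv> - 1/s1 - s1 * F"
  shows "(k0 + k3) * ((k1 - k0) * (- k1 - k3) - 1/s1 * m32)
      - m12 * (- 1/s0 * (- k1 - k3) - 1/s1 * m31)
      + m13 * (- 1/s0 * m32 - (k1 - k0) * m31) = 0"
proof -
  have nz: "s0 \<noteq> 0" "s1 \<noteq> 0" "s2 \<noteq> 0" "s3 \<noteq> 0" using s by auto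
  \<comment> \<open>Once \<open>s4\<close> is substituted, the sines enter the products of the
    determinant only through these squares, so only cotangents and the denominator \<open>E\<close>
    remain.\<close>
  have q: "1 / s0^2 = 1 + k0^2" "1 / s1^2 = 1 + k1^2" "1 / s3^2 = 1 + k3^2"
    using s nz by (auto simp: field_simps)
  have 1: "1/s1 * m32 = - (1 + k1^2) - F"
    unfolding m32_def q[symmetric] using nz by (simp add: field_simps power2_eq_square)
  have 2: "m12 = (1/s0) * (1 + (k1 + k2) * (1/s3^2) / E)"
    unfolding m12_def s4 using nz E(2) by (simp add: divide_simps power2_eq_square)
  have 3: "m13 = (1/s0) * (1/s1) * (1/s3^2) / E"
    unfolding m13_def s4 using nz E(2) by (simp add: divide_simps power2_eq_square)
  have 4: "m31 = - (s0 * s1 * E)"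
    unfolding m31_def s4 using nz by (simp add: divide_simps)
  have A: "m12 * (- 1/s0 * (- k1 - k3) - 1/s1 * m31) =
      (1 + (k1 + k2) * (1 + k3^2) / E) * ((1 + k0^2) * (k1 + k3) + E)"
    unfolding 2 4 q(3) unfolding q(1)[symmetric] using nz E(2)
    by (simp add: divide_simps power2_eq_square)
  have B: "m13 * (- 1/s0 * m32) = (1 + k3^2) / E * (1 + k0^2) * (1 + k1^2 + F)"
    unfolding 3 m32_def q(3) unfolding q(1,2)[symmetric] using nz E(2)
    by (simp add: divide_simps power2_eq_square) algebra
  have C: "m13 * m31 = - (1 + k3^2)"
    unfolding 3 4 q(3) using nz E(2) by (simp add: divide_simps)
  \<comment> \<open>The determinant multiplied by \<open>E\<close>: a polynomial identity in four
    independent cotangents.\<close>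
  have "(k0 + k3) * ((k1 - k0) * (- k1 - k3) + 1 + k1^2 + F) * E
      - (E + (k1 + k2) * (1 + k3^2)) * ((1 + k0^2) * (k1 + k3) + E)
      + (1 + k3^2) * (1 + k0^2) * (1 + k1^2 + F) + (k1 - k0) * (1 + k3^2) * E = 0"
    unfolding E(1) F by algebra
  then have "(k0 + k3) * ((k1 - k0) * (- k1 - k3) + 1 + k1^2 + F)
      - (1 + (k1 + k2) * (1 + k3^2) / E) * ((1 + k0^2) * (k1 + k3) + E)
      + (1 + k3^2) / E * (1 + k0^2) * (1 + k1^2 + F) + (k1 - k0) * (1 + k3^2) = 0"
    using E(2) by (simp add: divide_simps)
  then show ?thesis
    using 1 A B C by (simp only: right_diff_distrib) algebra
qed

section \<open>The closing condition and the evolute map of a pentagon\<close>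

definition closing :: "(int \<Rightarrow> real^2) \<Rightarrow> (int \<Rightarrow> real) \<Rightarrow> bool" where
  "closing d a \<longleftrightarrow> (\<forall>j. a (j + 5) = a j) \<and>
     a 0 *\<^sub>R d 0 + a 1 *\<^sub>R d 1 + a 2 *\<^sub>R d 2 + a 3 *\<^sub>R d 3 + a 4 *\<^sub>R d 4 = 0"

lemma closing_rot: "closing (\<lambda>j. rot (d j)) a \<longleftrightarrow> closing d a"
  unfolding closing_def vec_eq_iff forall_2 by auto

lemma periodic_mod:
  fixes f :: "int \<Rightarrow> 'a"
  assumes "\<And>j. f (j + p) = f j"
  shows "f (j mod p) = f j"
proof -
  have shift: "f (i + p * k) = f i" for i k
  proof (induction k rule: int_induct[where k = 0])
    case (step1 k)
    then show ?case using assms[of "i + p * k"] by (simp add: algebra_simps)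
  next
    case (step2 k)
    then show ?case using assms[of "i + p * (k - 1)"] by (simp add: algebra_simps)
  qed simp
  show ?thesis using shift[of "j mod p" "j div p"] by simp
qed

text \<open>The first three lengths are coordinates on the closing sequences: if they vanish, the
  closing equation is a linear relation between \<open>d 3\<close> and \<open>d 4\<close>, which are
  independent.\<close>

lemma closing_eqI:
  assumes "closing d f" "closing d g" "cross2 (d 3) (d 4) \<noteq> 0"
    and "f 0 = c * g 0" "f 1 = c * g 1" "f 2 = c * g 2"
  shows "f j = c * g j"
proof -
  define h where "h j = f j - c * g j" for j
  have per: "h (j + 5) = h j" for j
    using assms(1,2) by (simp add: h_def closing_def)
  have 0: "h 0 = 0" "h 1 = 0" "h 2 = 0"
    using assms by (auto simp: h_def)
  have f: "f 0 *\<^sub>R d 0 + f 1 *\<^sub>R d 1 + f 2 *\<^sub>R d 2 + f 3 *\<^sub>R d 3 + f 4 *\<^sub>R d 4 = 0"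
    and g: "g 0 *\<^sub>R d 0 + g 1 *\<^sub>R d 1 + g 2 *\<^sub>R d 2 + g 3 *\<^sub>R d 3 + g 4 *\<^sub>R d 4 = 0"
    using assms(1,2) by (auto simp: closing_def)
  have "h 3 *\<^sub>R d 3 + h 4 *\<^sub>R d 4 =
      (f 0 *\<^sub>R d 0 + f 1 *\<^sub>R d 1 + f 2 *\<^sub>R d 2 + f 3 *\<^sub>R d 3 + f 4 *\<^sub>R d 4)
      - c *\<^sub>R (g 0 *\<^sub>R d 0 + g 1 *\<^sub>R d 1 + g 2 *\<^sub>R d 2 + g 3 *\<^sub>R d 3 + g 4 *\<^sub>R d 4)"
    using assms(4-6) by (simp add: h_def algebra_simps)
  then have "h 3 *\<^sub>R d 3 + h 4 *\<^sub>R d 4 = 0" unfolding f g by simp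
  then have "h 3 * cross2 (d 3) (d 4) = 0" "h 4 * cross2 (d 3) (d 4) = 0"
    unfolding cross2_def vec_eq_iff forall_2 by (simp; algebra)+
  then have 34: "h 3 = 0" "h 4 = 0" using assms(3) by auto
  have "j mod 5 \<in> {0, 1, 2, 3, 4}" by auto
  then have "h (j mod 5) = 0" using 0 34 by auto
  then show ?thesis unfolding periodic_mod[of h, OF per] by (simp add: h_def)
qed

lemma pentagon_evolute_sides:
  fixes d :: "int \<Rightarrow> real^2"
  defines "s \<equiv> \<lambda>j. cross2 (d j) (d (j + 1))" and "c \<equiv> \<lambda>j. d j \<bullet> d (j + 1)"
  defines "T \<equiv> evolute_sides s c"
  assumes per: "\<And>j. d (j + 5) = d j"
    and unit: "\<And>j. d j \<bullet> d j = 1"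
    and nz: "\<And>j. s j \<noteq> 0"
    and cl: "closing d a" "closing d (T a)" "closing d (T (T a))" "closing d (T (T (T a)))"
  obtains \<mu> where "\<And>j. T (T (T a)) j = \<mu> * T a j"
proof -
  define k where "k j = c j / s j" for j
  define E where "E = k 0 * k 1 * k 2 + k 0 * k 1 * k 3 + k 0 * k 2 * k 3 + k 1 * k 2 * k 3
    - k 0 - k 1 - k 2 - k 3"
  define F where "F = k 1 * k 2 + k 1 * k 3 + k 2 * k 3 - 1"
  have ck: "c j = k j * s j" for j using nz by (simp add: k_def)
  \<comment> \<open>\<open>T a 0\<close> refers to index \<open>-1\<close>, which is index 4 by
    periodicity.\<close>
  have wrap: "d 5 = d 0" "s (-1) = s 4" "c (-1) = c 4" "k (-1) = k 4"
    using per[of 0] per[of "-1"] by (simp_all add: s_def c_def k_def)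
  have sc: "cross2 (d 0) (d 1) = s 0" "cross2 (d 1) (d 2) = s 1" "cross2 (d 2) (d 3) = s 2"
    "cross2 (d 3) (d 4) = s 3" "cross2 (d 4) (d 0) = s 4"
    "d 0 \<bullet> d 1 = c 0" "d 1 \<bullet> d 2 = c 1" "d 2 \<bullet> d 3 = c 2" "d 3 \<bullet> d 4 = c 3" "d 4 \<bullet> d 0 = c 4"
    by (simp_all add: s_def c_def wrap)
  have anti: "cross2 x y = - cross2 y x" for x y
    by (simp add: cross2_def)
  have sq: "(s j)\<^sup>2 * (1 + (k j)\<^sup>2) = 1" for j
  proof -
    have "(s j)\<^sup>2 + (c j)\<^sup>2 = 1"
      using unit[of j] unit[of "j + 1"] unfolding s_def c_def cross2_def inner_R2 by algebra
    then show ?thesis unfolding ck by algebra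
  qed
  note x = cross2_step(1)[OF unit] and i = cross2_step(2)[OF unit]
  \<comment> \<open>Sines of sums of two, three and four consecutive turning angles, with the
    product of the sines factored out; \<open>F\<close> and \<open>E\<close> are the remaining
    cotangent polynomials.\<close>
  have b: "cross2 (d 1) (d 3) = s 1 * s 2 * (k 1 + k 2)"
      "cross2 (d 2) (d 4) = s 2 * s 3 * (k 2 + k 3)"
      "cross2 (d 3) (d 0) = s 3 * s 4 * (k 3 + k 4)"
    using x[of "d 1" "d 3" 2] x[of "d 2" "d 4" 3] x[of "d 3" "d 0" 4]
    unfolding sc ck by algebra+
  have b14: "cross2 (d 1) (d 4) = s 1 * s 2 * s 3 * F"
    using x[of "d 1" "d 4" 3] i[of "d 1" "d 3" 2]
    unfolding b sc ck F_def by algebra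
  have b04: "cross2 (d 0) (d 4) = s 0 * s 1 * s 2 * s 3 * E"
    using x[of "d 0" "d 4" 3] x[of "d 0" "d 3" 2] x[of "d 0" "d 2" 1]
      i[of "d 0" "d 3" 2] i[of "d 0" "d 2" 1]
    unfolding sc ck E_def by algebra
  \<comment> \<open>The directions close up: the last turn leads from \<open>d 4\<close> back to
    \<open>d 0\<close>. As \<open>s 4\<close> is nonzero, so is \<open>E\<close>.\<close>
  have s4: "s 4 = - (s 0 * s 1 * s 2 * s 3 * E)"
    using b04 anti[of "d 4" "d 0"] unfolding sc by simp
  then have "E \<noteq> 0" using nz[of 4] by auto
  define m12 where "m12 = 1 / s 0 - s 1 * s 2 * (k 1 + k 2) / (s 3 * s 4)"
  define m13 where "m13 = - s 2 / (s 3 * s 4)"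
  define m31 where "m31 = s 4 / (s 2 * s 3)"
  define m32 where "m32 = - 1 / s 1 - s 1 * F"
  have det: "(k 0 + k 3) * ((k 1 - k 0) * (- k 1 - k 3) - 1 / s 1 * m32)
      - m12 * (- 1 / s 0 * (- k 1 - k 3) - 1 / s 1 * m31)
      + m13 * (- 1 / s 0 * m32 - (k 1 - k 0) * m31) = 0"
    unfolding m12_def m13_def m31_def m32_def
    by (rule pentagon_det_cot[OF sq sq sq sq E_def \<open>E \<noteq> 0\<close> F_def s4])
  have T: "T a 0 = ((k 0 + k 3) / 2) * a 0 + (m12 / 2) * a 1 + (m13 / 2) * a 2"
      "T a 1 = (- 1 / s 0 / 2) * a 0 + ((k 1 - k 0) / 2) * a 1 + (1 / s 1 / 2) * a 2"
      "T a 2 = (m31 / 2) * a 0 + (m32 / 2) * a 1 + ((- k 1 - k 3) / 2) * a 2"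
    if "closing d a" for a
  proof -
    have sum: "a 0 *\<^sub>R d 0 + a 1 *\<^sub>R d 1 + a 2 *\<^sub>R d 2 + a 3 *\<^sub>R d 3 + a 4 *\<^sub>R d 4 = 0"
      and a4: "a (-1) = a 4"
      using that spec[of "\<lambda>j. a (j + 5) = a j" "-1"] by (auto simp: closing_def)
    \<comment> \<open>Taking \<open>cross2\<close> of the closing equation with \<open>d 3\<close>
      eliminates \<open>a 3\<close>; below, \<open>d 4\<close> eliminates \<open>a 4\<close> in the
      same way.\<close>
    have "a 4 * cross2 (d 3) (d 4) =
        - (a 0 * cross2 (d 3) (d 0) - a 1 * cross2 (d 1) (d 3) - a 2 * cross2 (d 2) (d 3))"
      using sum unfolding cross2_def vec_eq_iff forall_2 by simp algebra
    then have 4: "a 4 = - (a 0 * (s 3 * s 4 * (k 3 + k 4)) - a 1 * (s 1 * s 2 * (k 1 + k 2))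
        - a 2 * s 2) / s 3"
      using nz[of 3] unfolding b sc by (simp add: field_simps)
    have "a 3 * cross2 (d 3) (d 4) =
        - (a 0 * - cross2 (d 4) (d 0) + a 1 * cross2 (d 1) (d 4) + a 2 * cross2 (d 2) (d 4))"
      using sum unfolding cross2_def vec_eq_iff forall_2 by simp algebra
    then have 3: "a 3 = - (a 0 * - s 4 + a 1 * (s 1 * s 2 * s 3 * F)
        + a 2 * (s 2 * s 3 * (k 2 + k 3))) / s 3"
      using nz[of 3] unfolding b b14 sc by (simp add: field_simps)
    show "T a 0 = ((k 0 + k 3) / 2) * a 0 + (m12 / 2) * a 1 + (m13 / 2) * a 2"
      using nz[of 0] nz[of 3] nz[of 4]
      by (simp add: T_def evolute_sides_def wrap a4 4 ck m12_def m13_def field_simps)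
    show "T a 1 = (- 1 / s 0 / 2) * a 0 + ((k 1 - k 0) / 2) * a 1 + (1 / s 1 / 2) * a 2"
      using nz[of 0] nz[of 1]
      by (simp add: T_def evolute_sides_def ck field_simps)
    show "T a 2 = (m31 / 2) * a 0 + (m32 / 2) * a 1 + ((- k 1 - k 3) / 2) * a 2"
      using nz[of 1] nz[of 2] nz[of 3]
      by (simp add: T_def evolute_sides_def 3 ck m31_def m32_def field_simps)
  qed
  have trace: "(k 0 + k 3) / 2 + (k 1 - k 0) / 2 + (- k 1 - k 3) / 2 = 0"
    by (simp add: field_simps)
  \<comment> \<open>The matrix of \<open>T\<close> is half the one in \<open>det\<close>, so its
    determinant is one eighth of that one.\<close>
  have det': "(k 0 + k 3) / 2 * ((k 1 - k 0) / 2 * ((- k 1 - k 3) / 2) - 1 / s 1 / 2 * (m32 / 2))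
      - m12 / 2 * (- 1 / s 0 / 2 * ((- k 1 - k 3) / 2) - 1 / s 1 / 2 * (m31 / 2))
      + m13 / 2 * (- 1 / s 0 / 2 * (m32 / 2) - (k 1 - k 0) / 2 * (m31 / 2)) = 0" (is "?L = 0")
  proof -
    have half: "p / 2 * (q / 2 * (r / 2) - t / 2 * (u / 2)) - v / 2 * (w / 2 * (r / 2) - t / 2 * (x / 2))
      + y / 2 * (w / 2 * (u / 2) - q / 2 * (x / 2)) =
      (p * (q * r - t * u) - v * (w * r - t * x) + y * (w * u - q * x)) / 8"
      for p q r t u v w x y :: real
      by (simp add: algebra_simps)
    show ?thesis unfolding half det by simp
  qed
  obtain \<mu> where \<mu>: "T (T (T a)) 0 = \<mu> * T a 0" "T (T (T a)) 1 = \<mu> * T a 1"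
      "T (T (T a)) 2 = \<mu> * T a 2"
    using traceless_singular_cube[OF trace det' T[OF cl(1)] T[OF cl(2)] T[OF cl(3)]] .
  have "cross2 (d 3) (d 4) \<noteq> 0"
    using nz[of 3] unfolding sc .
  from closing_eqI[OF cl(4,2) this \<mu>] show thesis by (rule that)
qed

section \<open>Periodicity, and from side lengths back to vertices\<close>

lemma vertex_periodic:
  assumes "\<And>j. l (j + p) = l j"
  shows "vertex l (j + p) = vertex l j"
  using assms[of j] assms[of "j + 1"] by (simp add: vertex_def add.commute add.left_commute)

lemma P_evolute_periodic:
  assumes "\<And>j. l (j + p) = l j"
  shows "P_evolute l (j + p) = P_evolute l j"
  using vertex_periodic[of l p, OF assms, of j] vertex_periodic[of l p, OF assms, of "j - 1"] assms[of j]
  by (simp add: P_evolute_def algebra_simps)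

lemma closing_side:
  assumes "directed l d" "\<And>j. l (j + 5) = l j" "\<And>j. d (j + 5) = d j"
  shows "closing d (side l d)"
proof -
  have v: "vertex l (j + 5) = vertex l j" for j
    using vertex_periodic assms(2) by blast
  have "side l d (j + 5) = side l d j" for j
    using v[of j] v[of "j - 1"] assms(3)[of j] by (simp add: side_def algebra_simps)
  \<comment> \<open>The edge vectors telescope to \<open>vertex l 4 - vertex l (-1)\<close>, which
    is zero by periodicity.\<close>
  moreover have "side l d 0 *\<^sub>R d 0 + side l d 1 *\<^sub>R d 1 + side l d 2 *\<^sub>R d 2 +
      side l d 3 *\<^sub>R d 3 + side l d 4 *\<^sub>R d 4 = 0"
    unfolding vertex_diff[OF assms(1), symmetric] using v[of "-1"] by simp
  ultimately show ?thesis by (simp add: closing_def)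
qed

theorem proposition4p15:
  fixes l :: "int \<Rightarrow> (real^2) set"
  assumes "polygon 5 l"
  shows "\<exists>(c::real) (v::real^2). \<forall>j::int.
           vertex ((P_evolute ^^ 3) l) j = c *\<^sub>R vertex (P_evolute l) j + v"
proof -
  obtain d where d: "directed l d" "\<And>j. d (j + 5) = d j"
    using polygon_directed[OF assms] by auto
  have per: "l (j + 5) = l j" for j
    using assms by (simp add: polygon_def)
  note per1 = P_evolute_periodic[of l, OF per]
  note per2 = P_evolute_periodic[of "P_evolute l", OF per1]
  note per3 = P_evolute_periodic[of "P_evolute (P_evolute l)", OF per2]
  note d1 = directed_P_evolute[OF d(1)]
  note d2 = directed_P_evolute[OF d1]
  note d3 = directed_P_evolute[OF d2]
  \<comment> \<open>Quarter turns preserve \<open>cross2\<close> and the inner product, so this one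
    map describes all three evolute steps.\<close>
  let ?T = "evolute_sides (\<lambda>j. cross2 (d j) (d (j + 1))) (\<lambda>j. d j \<bullet> d (j + 1))"
  let ?a = "side l d"
  have s1: "side (P_evolute l) (\<lambda>j. rot (d j)) = ?T ?a"
    using side_P_evolute[OF d(1)] .
  have s2: "side (P_evolute (P_evolute l)) (\<lambda>j. rot (rot (d j))) = ?T (?T ?a)"
    using side_P_evolute[OF d1] by (simp add: s1)
  have s3: "side (P_evolute (P_evolute (P_evolute l))) (\<lambda>j. rot (rot (rot (d j)))) =
      ?T (?T (?T ?a))"
    using side_P_evolute[OF d2] by (simp add: s2)
  have c0: "closing d ?a"
    using closing_side[of l d] d per by blast
  have c1: "closing d (?T ?a)"
    using closing_side[OF d1 per1] d(2) unfolding s1 closing_rot by simp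
  have c2: "closing d (?T (?T ?a))"
    using closing_side[OF d2 per2] d(2) unfolding s2 closing_rot by simp
  have c3: "closing d (?T (?T (?T ?a)))"
    using closing_side[OF d3 per3] d(2) unfolding s3 closing_rot by simp
  have "d j \<bullet> d j = 1" "cross2 (d j) (d (j + 1)) \<noteq> 0" for j
    using d(1) by (auto simp: directed_def)
  then obtain \<mu> where \<mu>: "\<And>j. ?T (?T (?T ?a)) j = \<mu> * ?T ?a j"
    using pentagon_evolute_sides[of d, OF d(2) _ _ c0 c1 c2 c3] by blast
  let ?V = "vertex (P_evolute l)" and ?W = "vertex (P_evolute (P_evolute (P_evolute l)))"
  \<comment> \<open>Three quarter turns reverse \<open>rot (d j)\<close>. The edge vectors of the
    third evolute are therefore \<open>- \<mu>\<close> times those of the first, and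
    \<open>w\<close> does not depend on \<open>j\<close>.\<close>
  define w where "w j = ?W j + \<mu> *\<^sub>R ?V j" for j
  have step: "w (j + 1) = w j" for j
  proof -
    have "?W (j + 1) - ?W j = - (\<mu> *\<^sub>R (?V (j + 1) - ?V j))"
      using vertex_diff[OF d3, of "j + 1"] vertex_diff[OF d1, of "j + 1"]
      unfolding s1 s3 \<mu> by (simp add: rot_rot_rot)
    then show ?thesis by (simp add: w_def algebra_simps)
  qed
  have "?W j = (- \<mu>) *\<^sub>R ?V j + w 0" for j
  proof -
    have "?W j = (- \<mu>) *\<^sub>R ?V j + w j" by (simp add: w_def)
    \<comment> \<open>A sequence on the integers with period 1 is constant, since
      \<open>j mod 1\<close> is 0.\<close>
    also have "w j = w 0" using periodic_mod[of w 1, OF step, of j] by simp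
    finally show ?thesis .
  qed
  moreover have "(P_evolute ^^ 3) l = P_evolute (P_evolute (P_evolute l))"
    by (simp add: numeral_3_eq_3)
  ultimately show ?thesis by metis
qed

end
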